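(* Let $\eta_j=c_0j^{-\alpha}$, $j=1,2,\ldots$, with $\alpha\in(0,1)$, $c_0>0$ and $c_0\max_i\|a_i\|^2\le 1$. For each noise level $\delta>0$ let $y^\delta\in\mathbb{R}^n$ be noisy data with $\|y^\delta-y^\dag\|=\delta$, and let $x_k^\delta$ be the SGD iterates for $y^\delta$ started from $x_1$. If the stopping index $k(\delta)\in\mathbb{N}$ satisfies $$\lim_{\delta\to0^+}k(\delta)=\infty\quad\text{and}\quad \lim_{\delta\to0^+}k(\delta)^{\frac{1-\alpha}{2}}\delta=0,$$ then $$\lim_{\delta\to0^+}\mathbb{E}\big[\|x_{k(\delta)}^\delta-x^\dag\|^2\big]=0.$$
   Context: Let $A\in\mathbb{R}^{n\times m}$, with $i$th row written as a column vector $a_i\in\mathbb{R}^m$, let $x_1\in\mathbb{R}^m$ be a fixed (deterministic) initial guess, and let $y^\dag\in\mathbb{R}^n$ be exact data in the range of $A$. The reference solution $x^\dag$ is the unique minimum-norm solution relative to $x_1$: $x^\dag=\arg\min\{\|x-x_1\|: x\in\mathbb{R}^m,\ Ax=y^\dag\}$. Noisy data are $y^\delta=y^\dag+\xi$ with noise level $\delta=\|\xi\|$; $\xi$ (a realization of an i.i.d. mean-zero Gaussian vector) is fixed, and all expectations are only over the random indices below. Stochastic gradient descent (SGD): $x_1^\delta=x_1$ and $$x_{k+1}^\delta=x_k^\delta-\eta_k\big((a_{i_k},x_k^\delta)-y^\delta_{i_k}\big)a_{i_k},\quad k=1,2,\ldots,$$ where the indices $i_k$ are drawn i.i.d. uniformly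 from $\{1,\ldots,n\}$ and $\eta_k>0$ are step sizes. $\|\cdot\|$ is the Euclidean norm for vectors and spectral norm for matrices. *)

theory Defs
  imports "HOL-Probability.Probability"
begin

definition min_norm_solution :: "real^'m^'n \<Rightarrow> real^'n \<Rightarrow> real^'m \<Rightarrow> real^'m" where
  "min_norm_solution A y x1 = (ARG_MIN (\<lambda>x. norm (x - x1)) x. A *v x = y)"

text \<open>
  The minimiser exists and is unique whenever the system is solvable, so the choice made by
  \<^const>\<open>arg_min\<close> is immaterial.
\<close>

lemma min_norm_solution_ex1:
  fixes A :: "real^'m^'n"
  assumes "y \<in> range (\<lambda>x. A *v x)"
  shows "\<exists>!x. is_arg_min (\<lambda>x. norm (x - x1)) (\<lambda>x. A *v x = y) x"
proof -
  let ?S = "{x. A *v x = y}"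
  have ne: "?S \<noteq> {}"
    using assms by auto
  have cl: "closed ?S"
    by (intro closed_Collect_eq continuous_intros matrix_vector_mult_linear_continuous_on)
  have cv: "convex ?S"
    by (auto simp: convex_def matrix_vector_right_distrib matrix_vector_mult_scaleR
        simp flip: scaleR_add_left)
  have iff: "is_arg_min (\<lambda>x. norm (x - x1)) (\<lambda>x. A *v x = y) x \<longleftrightarrow>
      x \<in> ?S \<and> (\<forall>z\<in>?S. dist x1 x \<le> dist x1 z)" for x
    by (auto simp: is_arg_min_linorder dist_norm norm_minus_commute)
  show ?thesis
  proof (rule ex1I[of _ "closest_point ?S x1"])
    show "is_arg_min (\<lambda>x. norm (x - x1)) (\<lambda>x. A *v x = y) (closest_point ?S x1)"
      unfolding iff using closest_point_exists[OF cl ne] by blast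
  next
    fix x
    assume "is_arg_min (\<lambda>x. norm (x - x1)) (\<lambda>x. A *v x = y) x"
    then show "x = closest_point ?S x1"
      unfolding iff using closest_point_unique[OF cv cl] by blast
  qed
qed

corollary min_norm_solution_is_arg_min:
  fixes A :: "real^'m^'n"
  assumes "y \<in> range (\<lambda>x. A *v x)"
  shows "is_arg_min (\<lambda>x. norm (x - x1)) (\<lambda>x. A *v x = y) (min_norm_solution A y x1)"
  unfolding min_norm_solution_def arg_min_def
  using ex1_implies_ex[OF min_norm_solution_ex1[OF assms]] by (rule someI_ex)

text \<open>
  Iterates are numbered from 1: the value at index 1 is the initial guess, and the value at
  index 0 is a dummy.  The argument \<open>i\<close> is one realisation of the index sequence.
\<close>

primrec sgd ::
  "real^'m^'n \<Rightarrow> real^'n \<Rightarrow> (nat \<Rightarrow> real) \<Rightarrow> real^'m \<Rightarrow> (nat \<Rightarrow> 'n) \<Rightarrow> nat \<Rightarrow> real^'m"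
where
  "sgd A y \<eta> x1 i 0 = x1"
| "sgd A y \<eta> x1 i (Suc k) =
    (if k = 0 then x1
     else sgd A y \<eta> x1 i k
       - (\<eta> k * (row (i k) A \<bullet> sgd A y \<eta> x1 i k - y $ i k)) *\<^sub>R row (i k) A)"

end

theory Submission
  imports Defs
begin

text \<open>
  For the error \<open>e\<close> and the noise \<open>\<xi>\<close>, one step with row \<open>a\<^sub>i\<close> and \<open>\<eta> \<parallel>a\<^sub>i\<parallel>\<^sup>2 \<le> 1\<close> gives
  \<open>\<parallel>e'\<parallel>\<^sup>2 \<le> \<parallel>e\<parallel>\<^sup>2 - \<eta> (a\<^sub>i, e)\<^sup>2 + \<eta> \<xi>\<^sub>i\<^sup>2\<close>.  As the current index is independent of the current iterate,
  averaging over it replaces the last two terms by \<open>- (\<eta>/n) \<parallel>A e\<parallel>\<^sup>2 + (\<eta>/n) \<delta>\<^sup>2\<close>.  All errors lie in the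
  orthogonal complement of the kernel of \<open>A\<close>: the initial one by minimality of the reference
  solution, and the updates because they are multiples of rows.  There \<open>\<parallel>A e\<parallel> \<ge> s \<parallel>e\<parallel>\<close> for some
  \<open>s > 0\<close>, so the mean square error contracts by \<open>1 - c \<eta>\<^sub>k\<close> up to an additive \<open>\<eta>\<^sub>k \<delta>\<^sup>2 / n\<close>.
  Since \<open>\<eta>\<^sub>k \<ge> c\<^sub>0 / k\<close>, it is at most \<open>exp (- q H\<^sub>k\<^sub>-\<^sub>1) \<parallel>e\<^sub>1\<parallel>\<^sup>2 + \<delta>\<^sup>2 / (n c)\<close> with \<open>H\<close> the harmonic numbers.
\<close>

section \<open>Linear algebra: a single step and the complement of the kernel\<close>

lemma norm_kaczmarz_step_le:
  fixes a e :: "'a::real_inner"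
  assumes "0 \<le> t" "t * (norm a)\<^sup>2 \<le> 1"
  shows "(norm (e - (t * (a \<bullet> e - r)) *\<^sub>R a))\<^sup>2 \<le> (norm e)\<^sup>2 - t * (a \<bullet> e)\<^sup>2 + t * r\<^sup>2"
proof -
  let ?p = "a \<bullet> e"
  have "(norm (e - (t * (?p - r)) *\<^sub>R a))\<^sup>2
      = (norm e)\<^sup>2 - 2 * t * (?p - r) * ?p + (t * (norm a)\<^sup>2) * (t * (?p - r)\<^sup>2)"
    unfolding power2_norm_eq_inner
    by (simp add: inner_diff_left inner_diff_right inner_commute[of e a])
       (simp add: algebra_simps power2_eq_square)
  also have "\<dots> \<le> (norm e)\<^sup>2 - 2 * t * (?p - r) * ?p + 1 * (t * (?p - r)\<^sup>2)"
    using assms by (intro add_left_mono mult_right_mono) auto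
  \<comment> \<open>Here \<open>(p - r)\<^sup>2 - 2 * (p - r) * p = r\<^sup>2 - p\<^sup>2\<close>,
    so the mixed terms in error and noise cancel exactly.\<close>
  also have "\<dots> = (norm e)\<^sup>2 - t * ?p\<^sup>2 + t * r\<^sup>2"
    by (simp add: algebra_simps power2_eq_square)
  finally show ?thesis .
qed

lemma min_norm_orthogonal_kernel:
  fixes A :: "real^'m^'n"
  assumes "y \<in> range (\<lambda>x. A *v x)" "A *v z = 0"
  shows "(x1 - min_norm_solution A y x1) \<bullet> z = 0"
proof (cases "z = 0")
  case False
  define x where "x = min_norm_solution A y x1"
  have min: "A *v x = y" "\<And>w. A *v w = y \<Longrightarrow> norm (x - x1) \<le> norm (w - x1)"
    using min_norm_solution_is_arg_min[OF assms(1), of x1]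
    by (auto simp: is_arg_min_linorder x_def)
  let ?d = "x1 - x"
  \<comment> \<open>This \<open>t\<close> minimises \<open>norm (?d - t *\<^sub>R z)\<close>. Moving
    from \<open>x\<close> along the kernel vector \<open>z\<close> keeps the equation solved, so any
    gain \<open>(?d \<bullet> z)\<^sup>2 / (z \<bullet> z)\<close> would contradict
    minimality.\<close>
  define t where "t = (?d \<bullet> z) / (z \<bullet> z)"
  have zz: "z \<bullet> z > 0" using False by simp
  have "norm (x - x1) \<le> norm (x + t *\<^sub>R z - x1)"
    using assms(2) min(1)
    by (intro min(2)) (simp add: matrix_vector_right_distrib matrix_vector_mult_scaleR)
  also have "\<dots> = norm (?d - t *\<^sub>R z)"
    by (metis diff_diff_eq norm_minus_commute)
  finally have "norm ?d \<le> norm (?d - t *\<^sub>R z)"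
    by (simp add: norm_minus_commute)
  then have "(norm ?d)\<^sup>2 \<le> (norm (?d - t *\<^sub>R z))\<^sup>2"
    by (intro power_mono) auto
  also have "\<dots> = (norm ?d)\<^sup>2 - 2 * t * (?d \<bullet> z) + t\<^sup>2 * (z \<bullet> z)"
    unfolding power2_norm_eq_inner
    by (simp only: inner_diff_left inner_diff_right inner_scaleR_left inner_scaleR_right inner_commute)
       (simp add: algebra_simps power2_eq_square inner_commute)
  also have "\<dots> = (norm ?d)\<^sup>2 - (?d \<bullet> z)\<^sup>2 / (z \<bullet> z)"
    using zz by (simp add: t_def field_simps power2_eq_square)
  finally have "(?d \<bullet> z)\<^sup>2 / (z \<bullet> z) \<le> 0" by simp
  then have "(?d \<bullet> z)\<^sup>2 \<le> 0"
    using zz by (simp only: divide_le_0_iff) linarith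
  then show ?thesis by (simp add: x_def)
qed simp

lemma row_inner_eq_matrix_vector_nth:
  fixes A :: "real^'m^'n"
  shows "row i A \<bullet> x = (A *v x) $ i"
  by (simp add: matrix_vector_mul_component row_def vec_nth_inverse)

text \<open>A kernel vector in this subspace is orthogonal to itself, so \<open>A\<close> is
  injective there; in finite dimension injectivity yields a uniform lower bound.\<close>

lemma matrix_lower_bound_on_kernel_complement:
  fixes A :: "real^'m^'n"
  obtains s where "s > 0"
    "\<And>v. (\<And>z. A *v z = 0 \<Longrightarrow> v \<bullet> z = 0) \<Longrightarrow> s * norm v \<le> norm (A *v v)"
proof -
  let ?S = "{v. \<forall>z. A *v z = 0 \<longrightarrow> v \<bullet> z = 0}"
  have sub: "subspace ?S"
    by (auto simp: subspace_def inner_add_left)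
  have "\<exists>s>0. \<forall>v\<in>?S. s * norm v \<le> norm (A *v v)"
    by (intro injective_imp_isometric closed_subspace sub matrix_vector_mul_bounded_linear) auto
  with that show thesis by auto
qed

section \<open>Iterates along index sequences: error, finiteness, measurability\<close>

lemma sgd_error_orthogonal_kernel:
  fixes A :: "real^'m^'n"
  assumes "A *v z = 0" "(x1 - x) \<bullet> z = 0"
  shows "(sgd A y \<eta> x1 i k - x) \<bullet> z = 0"
  using assms
  by (induction k) (auto simp: inner_diff_left row_inner_eq_matrix_vector_nth)

lemma sgd_error_step_le:
  fixes A :: "real^'m^'n"
  assumes "k \<ge> 1" "0 \<le> \<eta> k" "\<eta> k * (norm (row (i k) A))\<^sup>2 \<le> 1"
  shows "(norm (sgd A y \<eta> x1 i (Suc k) - x))\<^sup>2 \<le> (norm (sgd A y \<eta> x1 i k - x))\<^sup>2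
    - \<eta> k * (row (i k) A \<bullet> (sgd A y \<eta> x1 i k - x))\<^sup>2 + \<eta> k * ((y - A *v x) $ i k)\<^sup>2"
proof -
  let ?u = "sgd A y \<eta> x1 i k"
  \<comment> \<open>The residual splits into the response to the error and the noise component
    \<open>(y - A *v x) $ i k\<close>, which plays the role of \<open>r\<close> in the one-step
    estimate.\<close>
  have "row (i k) A \<bullet> ?u - y $ i k = row (i k) A \<bullet> (?u - x) - (y - A *v x) $ i k"
    by (simp add: inner_diff_right row_inner_eq_matrix_vector_nth)
  then have "sgd A y \<eta> x1 i (Suc k) - x =
      (?u - x) - (\<eta> k * (row (i k) A \<bullet> (?u - x) - (y - A *v x) $ i k)) *\<^sub>R row (i k) A"
    using assms(1) by (simp add: algebra_simps)
  then show ?thesis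
    using norm_kaczmarz_step_le[OF assms(2,3)] by metis
qed

text \<open>Each step is determined by the current iterate and one index from a finite type.
  Finiteness makes real functions of an iterate bounded, which settles integrability.\<close>

lemma finite_range_sgd:
  fixes A :: "real^'m^'n"
  shows "finite (range (\<lambda>i. sgd A y \<eta> x1 i k))"
proof (induction k)
  case (Suc k)
  let ?g = "\<lambda>(u, j). if k = 0 then x1 else u - (\<eta> k * (row j A \<bullet> u - y $ j)) *\<^sub>R row j A"
  have "range (\<lambda>i. sgd A y \<eta> x1 i (Suc k)) \<subseteq> ?g ` (range (\<lambda>i. sgd A y \<eta> x1 i k) \<times> UNIV)"
    by (auto simp: image_iff)
  then show ?case
    by (rule finite_subset) (intro finite_imageI finite_cartesian_product Suc finite)
qed simp

text \<open>Index \<open>k\<close> first enters in the step from \<open>k\<close> to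
  \<open>Suc k\<close>. Hence iterate \<open>k\<close> is a function of the indices in
  \<open>{1..<k}\<close>, which is what independence of the current index rests on.\<close>

lemma sgd_cong:
  assumes "\<And>j. 1 \<le> j \<Longrightarrow> j < k \<Longrightarrow> i j = i' j"
  shows "sgd A y \<eta> x1 i k = sgd A y \<eta> x1 i' k"
  using assms by (induction k) auto

text \<open>The space \<open>N\<close> is general because it serves both as the probability space
  and as the product space over \<open>{1..<k}\<close>.\<close>

lemma borel_measurable_sgd:
  fixes A :: "real^'m^'n"
  assumes "\<And>j. 1 \<le> j \<Longrightarrow> j < k \<Longrightarrow> (\<lambda>\<omega>. i \<omega> j) \<in> N \<rightarrow>\<^sub>M count_space UNIV"
  shows "(\<lambda>\<omega>. sgd A y \<eta> x1 (i \<omega>) k) \<in> borel_measurable N"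
  using assms
proof (induction k)
  case (Suc k)
  show ?case
  proof (cases "k = 0")
    case False
    then have i: "(\<lambda>\<omega>. i \<omega> k) \<in> N \<rightarrow>\<^sub>M count_space UNIV"
      using Suc.prems by auto
    have [measurable]: "(\<lambda>\<omega>. sgd A y \<eta> x1 (i \<omega>) k) \<in> borel_measurable N"
      using Suc by auto
    \<comment> \<open>The chosen row is itself random: measurability is shown for each fixed row
      \<open>j\<close> and glued over the finitely many values of
      \<open>i \<omega> k\<close>.\<close>
    have "(\<lambda>\<omega>. (\<lambda>j \<omega>. sgd A y \<eta> x1 (i \<omega>) k
        - (\<eta> k * (row j A \<bullet> sgd A y \<eta> x1 (i \<omega>) k - y $ j)) *\<^sub>R row j A) (i \<omega> k) \<omega>) \<in> borel_measurable N"
      by (rule measurable_compose_countable'[OF _ i countable_finite]) auto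
    with False show ?thesis by simp
  qed simp
qed simp

section \<open>Expectations over the random indices\<close>

context prob_space
begin

lemma integrable_sgd:
  fixes A :: "real^'m^'n" and f :: "real^'m \<Rightarrow> real"
  assumes I: "\<And>j. 1 \<le> j \<Longrightarrow> I j \<in> M \<rightarrow>\<^sub>M count_space UNIV"
    and [measurable]: "f \<in> borel_measurable borel"
  shows "integrable M (\<lambda>\<omega>. f (sgd A y \<eta> x1 (\<lambda>j. I j \<omega>) k))"
proof -
  have "finite (f ` range (\<lambda>i. sgd A y \<eta> x1 i k))"
    by (intro finite_imageI finite_range_sgd)
  then obtain B where "\<And>i. norm (f (sgd A y \<eta> x1 i k)) \<le> B"
    using finite_imp_bounded bounded_iff by (metis rangeI image_eqI)
  moreover have [measurable]: "(\<lambda>\<omega>. sgd A y \<eta> x1 (\<lambda>j. I j \<omega>) k) \<in> borel_measurable M"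
    by (intro borel_measurable_sgd I)
  ultimately show ?thesis
    by (intro integrable_const_bound[of _ B]) auto
qed

text \<open>This replaces conditioning on the past: \<open>f\<close> is split by indicators of the
  values of \<open>I k\<close>, and in each product the indicator is independent of the iterate and
  has mean \<open>1 / CARD('n)\<close>.\<close>

lemma
  fixes A :: "real^'m^'n" and f :: "'n \<Rightarrow> real^'m \<Rightarrow> real"
  assumes indep: "indep_vars (\<lambda>_. count_space UNIV) I {1..}"
    and unif: "distr M (count_space UNIV) (I k) = uniform_count_measure UNIV"
    and k: "k \<ge> 1"
    and f[measurable]: "\<And>i. f i \<in> borel_measurable borel"
  shows expectation_sgd_fresh_index:
      "expectation (\<lambda>\<omega>. f (I k \<omega>) (sgd A y \<eta> x1 (\<lambda>j. I j \<omega>) k))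
        = (\<Sum>i\<in>UNIV. expectation (\<lambda>\<omega>. f i (sgd A y \<eta> x1 (\<lambda>j. I j \<omega>) k))) / CARD('n)" (is ?eq)
    and integrable_sgd_fresh_index:
      "integrable M (\<lambda>\<omega>. f (I k \<omega>) (sgd A y \<eta> x1 (\<lambda>j. I j \<omega>) k))" (is ?int)
proof -
  let ?x = "\<lambda>\<omega>. sgd A y \<eta> x1 (\<lambda>j. I j \<omega>) k"
  let ?C = "\<lambda>_. count_space (UNIV :: 'n set)"
  have I: "I j \<in> M \<rightarrow>\<^sub>M count_space UNIV" if "1 \<le> j" for j
    using indep that by (auto simp: indep_vars_def)
  have int_x: "integrable M (\<lambda>\<omega>. f i (?x \<omega>))" for i
    by (intro integrable_sgd I f)
  have int_I: "integrable M (\<lambda>\<omega>. indicator {i} (I k \<omega>) :: real)" for i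
    using I[OF k] by (intro integrable_const_bound[of _ 1]) auto
  have exp_I: "expectation (\<lambda>\<omega>. indicator {i} (I k \<omega>)) = 1 / CARD('n)" for i
  proof -
    have "expectation (\<lambda>\<omega>. indicator {i} (I k \<omega>) :: real)
        = (\<integral>j. indicator {i} j \<partial>distr M (count_space UNIV) (I k))"
      using I[OF k] by (intro integral_distr[symmetric]) auto
    also have "\<dots> = 1 / CARD('n)"
      by (simp add: unif measure_uniform_count_measure space_uniform_count_measure)
    finally show ?thesis .
  qed
  have ind: "indep_var borel (\<lambda>\<omega>. indicator {i} (I k \<omega>) :: real) borel (\<lambda>\<omega>. f i (?x \<omega>))" for i
  proof -
    \<comment> \<open>The blocks \<open>{k}\<close> and \<open>{1..<k}\<close> are disjoint; the
      indicator reads only the first and the iterate only the second.\<close>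
    have "indep_var (PiM {k} ?C) (\<lambda>\<omega>. restrict (\<lambda>j. I j \<omega>) {k})
        (PiM {1..<k} ?C) (\<lambda>\<omega>. restrict (\<lambda>j. I j \<omega>) {1..<k})"
      using k by (intro indep_var_restrict[OF indep]) auto
    moreover have "(\<lambda>g. indicator {i} (g k) :: real) \<in> borel_measurable (PiM {k} ?C)"
      by measurable
    moreover have "(\<lambda>g. f i (sgd A y \<eta> x1 g k)) \<in> borel_measurable (PiM {1..<k} ?C)"
      by (intro measurable_compose[OF borel_measurable_sgd f]) measurable
    ultimately have "indep_var
        borel ((\<lambda>g. indicator {i} (g k) :: real) \<circ> (\<lambda>\<omega>. restrict (\<lambda>j. I j \<omega>) {k}))
        borel ((\<lambda>g. f i (sgd A y \<eta> x1 g k)) \<circ> (\<lambda>\<omega>. restrict (\<lambda>j. I j \<omega>) {1..<k}))"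
      by (rule indep_var_compose)
    moreover have "sgd A y \<eta> x1 (restrict (\<lambda>j. I j \<omega>) {1..<k}) k = ?x \<omega>" for \<omega>
      by (rule sgd_cong) auto
    ultimately show ?thesis
      by (simp add: o_def)
  qed
  have decomp: "f (I k \<omega>) (?x \<omega>) = (\<Sum>i\<in>UNIV. indicator {i} (I k \<omega>) * f i (?x \<omega>))" for \<omega>
    by (simp add: indicator_def if_distrib[of "\<lambda>t. t * _"] cong: if_cong)
  have int: "integrable M (\<lambda>\<omega>. indicator {i} (I k \<omega>) * f i (?x \<omega>))" for i
    by (rule indep_var_integrable[OF ind int_I int_x])
  show ?int
    unfolding decomp by (intro Bochner_Integration.integrable_sum int)
  show ?eq
    unfolding decomp
    by (subst Bochner_Integration.integral_sum[OF int])
       (simp add: exp_I indep_var_lebesgue_integral[OF ind int_I int_x] sum_divide_distrib)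
qed

lemma sgd_mean_square_error_step_le:
  fixes A :: "real^'m^'n"
  assumes indep: "indep_vars (\<lambda>_. count_space UNIV) I {1..}"
    and unif: "distr M (count_space UNIV) (I k) = uniform_count_measure UNIV"
    and k: "k \<ge> 1"
    and \<eta>: "0 \<le> \<eta> k" "\<And>i. \<eta> k * (norm (row i A))\<^sup>2 \<le> 1"
    and s: "0 \<le> s"
      "\<And>i. s * norm (sgd A y \<eta> x1 i k - x) \<le> norm (A *v (sgd A y \<eta> x1 i k - x))"
  defines "b \<equiv> \<lambda>k. expectation (\<lambda>\<omega>. (norm (sgd A y \<eta> x1 (\<lambda>j. I j \<omega>) k - x))\<^sup>2)"
  shows "b (Suc k) \<le> b k - \<eta> k * s\<^sup>2 / CARD('n) * b k + \<eta> k / CARD('n) * (norm (y - A *v x))\<^sup>2"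
proof -
  let ?u = "\<lambda>\<omega>. sgd A y \<eta> x1 (\<lambda>j. I j \<omega>) k"
  let ?n = "real CARD('n)"
  \<comment> \<open>The right-hand side of the one-step bound, with the row \<open>i\<close> as a
    free parameter so that it can be averaged.\<close>
  define f where "f i v = (norm (v - x))\<^sup>2 - \<eta> k * (row i A \<bullet> (v - x))\<^sup>2
      + \<eta> k * ((y - A *v x) $ i)\<^sup>2" for i and v :: "real^'m"
  have f[measurable]: "f i \<in> borel_measurable borel" for i
    unfolding f_def by measurable
  have I: "I j \<in> M \<rightarrow>\<^sub>M count_space UNIV" if "1 \<le> j" for j
    using indep that by (auto simp: indep_vars_def)
  note int = integrable_sgd[of I, OF I]
  \<comment> \<open>Summing over the rows assembles the squared components into squared norms of
    \<open>A *v (v - x)\<close> and of the noise.\<close>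
  have sumf: "(\<Sum>i\<in>UNIV. f i v) = ?n * (norm (v - x))\<^sup>2 - \<eta> k * (norm (A *v (v - x)))\<^sup>2
      + \<eta> k * (norm (y - A *v x))\<^sup>2" for v
    by (simp add: f_def sum.distrib sum_subtractf row_inner_eq_matrix_vector_nth norm_vec_def
        L2_set_def sum_nonneg flip: sum_distrib_left)
  have "b (Suc k) \<le> expectation (\<lambda>\<omega>. f (I k \<omega>) (?u \<omega>))"
    unfolding b_def f_def
    by (intro integral_mono int sgd_error_step_le k \<eta>
        integrable_sgd_fresh_index[OF indep unif k f, unfolded f_def]) auto
  also have "\<dots> = expectation (\<lambda>\<omega>. \<Sum>i\<in>UNIV. f i (?u \<omega>)) / ?n"
    by (subst expectation_sgd_fresh_index[OF indep unif k f])
       (simp add: Bochner_Integration.integral_sum int)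
  also have "\<dots> \<le> expectation (\<lambda>\<omega>. (?n - \<eta> k * s\<^sup>2) * (norm (?u \<omega> - x))\<^sup>2
      + \<eta> k * (norm (y - A *v x))\<^sup>2) / ?n"
  proof (intro divide_right_mono integral_mono)
    show "integrable M (\<lambda>\<omega>. \<Sum>i\<in>UNIV. f i (?u \<omega>))"
      by (intro Bochner_Integration.integrable_sum int f)
    show "integrable M (\<lambda>\<omega>. (?n - \<eta> k * s\<^sup>2) * (norm (?u \<omega> - x))\<^sup>2 + \<eta> k * (norm (y - A *v x))\<^sup>2)"
      by (rule int) auto
    fix \<omega>
    have "(s * norm (?u \<omega> - x))\<^sup>2 \<le> (norm (A *v (?u \<omega> - x)))\<^sup>2"
      using s by (intro power_mono) auto
    then have "\<eta> k * (s\<^sup>2 * (norm (?u \<omega> - x))\<^sup>2) \<le> \<eta> k * (norm (A *v (?u \<omega> - x)))\<^sup>2"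
      using \<eta>(1) by (intro mult_left_mono) (auto simp: power_mult_distrib)
    then show "(\<Sum>i\<in>UNIV. f i (?u \<omega>))
        \<le> (?n - \<eta> k * s\<^sup>2) * (norm (?u \<omega> - x))\<^sup>2 + \<eta> k * (norm (y - A *v x))\<^sup>2"
      unfolding sumf by (simp add: algebra_simps)
  qed simp
  also have "\<dots> = ((?n - \<eta> k * s\<^sup>2) * b k + \<eta> k * (norm (y - A *v x))\<^sup>2) / ?n"
    unfolding b_def
    by (subst Bochner_Integration.integral_add) (auto intro!: int simp: prob_space)
  also have "\<dots> = b k - \<eta> k * s\<^sup>2 / ?n * b k + \<eta> k / ?n * (norm (y - A *v x))\<^sup>2"
    by (simp add: field_simps)
  finally show ?thesis .
qed

end

section \<open>The scalar recursion and the limit\<close>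

lemma contraction_recursion_le:
  fixes b t :: "nat \<Rightarrow> real"
  assumes step: "\<And>k. k \<ge> 1 \<Longrightarrow> b (Suc k) \<le> (1 - t k) * b k + t k * D"
    and t: "\<And>k. k \<ge> 1 \<Longrightarrow> q / real k \<le> t k" "\<And>k. k \<ge> 1 \<Longrightarrow> t k \<le> 1"
    and "b 1 \<ge> 0" "D \<ge> 0"
  shows "b (Suc m) \<le> exp (- q * harm m) * b 1 + D"
proof (induction m)
  case (Suc m)
  let ?B = "exp (- q * harm m) * b 1"
  have "b (Suc (Suc m)) \<le> (1 - t (Suc m)) * b (Suc m) + t (Suc m) * D"
    by (rule step) simp
  also have "\<dots> \<le> (1 - t (Suc m)) * (?B + D) + t (Suc m) * D"
    using t(2)[of "Suc m"] by (intro add_right_mono mult_left_mono Suc) auto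
  \<comment> \<open>\<open>D\<close> is the fixed point of the affine recursion, so only the part
    \<open>?B\<close> is contracted.\<close>
  also have "\<dots> = (1 - t (Suc m)) * ?B + D"
    by (simp add: algebra_simps)
  \<comment> \<open>Bounding each factor by an exponential turns the product of the factors into the
    harmonic sum in the exponent.\<close>
  also have "1 - t (Suc m) \<le> exp (- q / real (Suc m))"
    using t(1)[of "Suc m"] exp_ge_add_one_self[of "- q / real (Suc m)"] by simp
  then have "(1 - t (Suc m)) * ?B + D \<le> exp (- q / real (Suc m)) * ?B + D"
    using assms(4) by (intro add_right_mono mult_right_mono) auto
  also have "\<dots> = exp (- q * harm (Suc m)) * b 1 + D"
    by (simp add: harm_Suc divide_inverse distrib_left exp_add[symmetric] mult.assoc[symmetric] add.commute)
  finally show ?case .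
qed (use assms in \<open>simp add: harm_def\<close>)

theorem theorem2p1:
  fixes A :: "real^'m^'n"
    and x1 :: "real^'m"
    and ydag :: "real^'n"
    and ydelta :: "real \<Rightarrow> real^'n"
    and \<alpha> c0 :: real
    and \<eta> :: "nat \<Rightarrow> real"
    and M :: "'w measure"
    and I :: "nat \<Rightarrow> 'w \<Rightarrow> 'n"
    and k :: "real \<Rightarrow> nat"
  assumes exact_data: "ydag \<in> range (\<lambda>x. A *v x)"
    and prob: "prob_space M"
    and indices_indep: "prob_space.indep_vars M (\<lambda>_. count_space UNIV) I {1..}"
    and indices_uniform:
      "\<And>j. j \<ge> 1 \<Longrightarrow> distr M (count_space UNIV) (I j) = uniform_count_measure UNIV"
    and alpha: "0 < \<alpha>" "\<alpha> < 1"
    and c0: "c0 > 0" "c0 * (MAX i. (norm (row i A))\<^sup>2) \<le> 1"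
    and stepsize: "\<And>j. j \<ge> 1 \<Longrightarrow> \<eta> j = c0 * real j powr (- \<alpha>)"
    and noise: "\<And>\<delta>. \<delta> > 0 \<Longrightarrow> norm (ydelta \<delta> - ydag) = \<delta>"
    and stop_infinity: "filterlim k at_top (at_right 0)"
    and stop_rate: "((\<lambda>\<delta>. real (k \<delta>) powr ((1 - \<alpha>) / 2) * \<delta>) \<longlongrightarrow> 0) (at_right 0)"
  shows "((\<lambda>\<delta>. prob_space.expectation M
            (\<lambda>\<omega>. (norm (sgd A (ydelta \<delta>) \<eta> x1 (\<lambda>j. I j \<omega>) (k \<delta>)
                         - min_norm_solution A ydag x1))\<^sup>2))
          \<longlongrightarrow> 0) (at_right 0)"
proof -
  interpret prob_space M by (rule prob)
  define x where "x = min_norm_solution A ydag x1"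
  define b where "b \<delta> m = expectation (\<lambda>\<omega>. (norm (sgd A (ydelta \<delta>) \<eta> x1 (\<lambda>j. I j \<omega>) m - x))\<^sup>2)" for \<delta> m
  let ?n = "real CARD('n)"
  have Ax: "A *v x = ydag"
    using min_norm_solution_is_arg_min[OF exact_data, of x1]
    by (simp add: is_arg_min_linorder x_def)
  obtain s where s: "s > 0"
    "\<And>v. (\<And>z. A *v z = 0 \<Longrightarrow> v \<bullet> z = 0) \<Longrightarrow> s * norm v \<le> norm (A *v v)"
    by (rule matrix_lower_bound_on_kernel_complement[of A]) blast
  have lower: "s * norm (sgd A y \<eta> x1 i j - x) \<le> norm (A *v (sgd A y \<eta> x1 i j - x))" for y i j
    using min_norm_orthogonal_kernel[OF exact_data]
    by (intro s(2) sgd_error_orthogonal_kernel) (auto simp: x_def)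
  \<comment> \<open>The lower bound makes the steps sum to infinity, forcing the initial error to
    decay; the upper bound keeps the steps admissible.\<close>
  have \<eta>: "c0 / real j \<le> \<eta> j" "0 \<le> \<eta> j" "\<eta> j \<le> c0" if "j \<ge> 1" for j
  proof -
    have "real j powr (- 1) \<le> real j powr (- \<alpha>)" "real j powr (- \<alpha>) \<le> real j powr 0"
      using that alpha by (intro powr_mono; simp)+
    then have "c0 * (1 / real j) \<le> \<eta> j" "\<eta> j \<le> c0 * 1"
      unfolding stepsize[OF that] using c0(1) that
      by (intro mult_left_mono; simp add: powr_minus_divide)+
    moreover have "0 \<le> \<eta> j"
      using c0(1) by (simp add: stepsize[OF that])
    ultimately show "c0 / real j \<le> \<eta> j" "0 \<le> \<eta> j" "\<eta> j \<le> c0" by simp_all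
  qed
  have \<eta>_row: "\<eta> j * (norm (row i A))\<^sup>2 \<le> 1" if "j \<ge> 1" for j i
  proof -
    have "\<eta> j * (norm (row i A))\<^sup>2 \<le> c0 * (MAX i. (norm (row i A))\<^sup>2)"
      using \<eta>[OF that] c0(1) by (intro mult_mono Max_ge) auto
    with c0(2) show ?thesis by simp
  qed
  \<comment> \<open>\<open>s\<^sup>2 / ?n\<close> is the contraction rate of the mean square error;
    the cap \<open>1 / c0\<close> ensures \<open>c * \<eta> j \<le> 1\<close>, so that the factors
    \<open>1 - c * \<eta> j\<close> are nonnegative.\<close>
  define c where "c = min (s\<^sup>2 / ?n) (1 / c0)"
  have c: "c > 0" "c \<le> s\<^sup>2 / ?n" "c * c0 \<le> 1"
    using s(1) c0(1) by (auto simp: c_def min_def field_simps)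
  have bound: "b \<delta> (Suc m) \<le> exp (- (c * c0) * harm m) * (norm (x1 - x))\<^sup>2 + \<delta>\<^sup>2 / (?n * c)"
    if "\<delta> > 0" for \<delta> m
  proof -
    have b1: "b \<delta> 1 = (norm (x1 - x))\<^sup>2"
      by (simp add: b_def prob_space)
    \<comment> \<open>The fixed point \<open>\<delta>\<^sup>2 / (?n * c)\<close> is chosen so that
      its product with \<open>c * \<eta> j\<close> is the noise term
      \<open>\<eta> j / ?n * \<delta>\<^sup>2\<close>.\<close>
    have "b \<delta> (Suc m) \<le> exp (- (c * c0) * harm m) * b \<delta> 1 + \<delta>\<^sup>2 / (?n * c)"
    proof (rule contraction_recursion_le[where t = "\<lambda>j. c * \<eta> j"])
      fix j :: nat assume j: "j \<ge> 1"
      have "b \<delta> (Suc j) \<le> b \<delta> j - \<eta> j * s\<^sup>2 / ?n * b \<delta> j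
          + \<eta> j / ?n * (norm (ydelta \<delta> - A *v x))\<^sup>2"
        unfolding b_def using s(1) lower \<eta> \<eta>_row j indices_uniform indices_indep
        by (intro sgd_mean_square_error_step_le) auto
      also have "\<dots> = b \<delta> j - s\<^sup>2 / ?n * (\<eta> j * b \<delta> j) + \<eta> j / ?n * \<delta>\<^sup>2"
        using noise[OF that] by (simp add: Ax)
      also have "\<dots> \<le> b \<delta> j - c * (\<eta> j * b \<delta> j) + \<eta> j / ?n * \<delta>\<^sup>2"
        using c \<eta>[OF j]
        by (intro add_right_mono diff_left_mono mult_right_mono mult_nonneg_nonneg) (auto simp: b_def)
      also have "\<dots> = (1 - c * \<eta> j) * b \<delta> j + c * \<eta> j * (\<delta>\<^sup>2 / (?n * c))"
        using c(1) by (simp add: field_simps)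
      finally show "b \<delta> (Suc j) \<le> (1 - c * \<eta> j) * b \<delta> j + c * \<eta> j * (\<delta>\<^sup>2 / (?n * c))" .
      show "c * c0 / real j \<le> c * \<eta> j"
        using mult_left_mono[OF \<eta>(1)[OF j], of c] c(1) by simp
      show "c * \<eta> j \<le> 1"
        using mult_left_mono[OF \<eta>(3)[OF j], of c] c(1,3) by linarith
    qed (use b1 c(1) in auto)
    then show ?thesis unfolding b1 .
  qed
  \<comment> \<open>Iterate \<open>k \<delta>\<close> has undergone \<open>k \<delta> - 1\<close>
    steps; divergence of the harmonic numbers drives the exponential factor to 0.\<close>
  have "filterlim (\<lambda>\<delta>. k \<delta> - 1) at_top (at_right 0)"
    using filterlim_compose[OF filterlim_minus_const_nat_at_top stop_infinity] .
  then have "filterlim (\<lambda>\<delta>. harm (k \<delta> - 1) :: real) at_top (at_right 0)"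
    by (rule filterlim_compose[OF harm_at_top])
  then have "filterlim (\<lambda>\<delta>. - (c * c0) * harm (k \<delta> - 1)) at_bot (at_right 0)"
    using c(1) c0(1) by (intro filterlim_tendsto_neg_mult_at_bot[OF tendsto_const]) auto
  then have "((\<lambda>\<delta>. exp (- (c * c0) * harm (k \<delta> - 1))) \<longlongrightarrow> 0) (at_right 0)"
    by (rule filterlim_compose[OF exp_at_bot])
  moreover have "((\<lambda>\<delta>. \<delta>\<^sup>2 / (?n * c)) \<longlongrightarrow> 0\<^sup>2 / (?n * c)) (at_right 0)"
    using c(1) by (intro tendsto_intros) auto
  ultimately have "((\<lambda>\<delta>. exp (- (c * c0) * harm (k \<delta> - 1)) * (norm (x1 - x))\<^sup>2
      + \<delta>\<^sup>2 / (?n * c)) \<longlongrightarrow> 0 * (norm (x1 - x))\<^sup>2 + 0\<^sup>2 / (?n * c)) (at_right 0)"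
    by (intro tendsto_add tendsto_mult tendsto_const)
  then have upper: "((\<lambda>\<delta>. exp (- (c * c0) * harm (k \<delta> - 1)) * (norm (x1 - x))\<^sup>2
      + \<delta>\<^sup>2 / (?n * c)) \<longlongrightarrow> 0) (at_right 0)"
    by simp
  \<comment> \<open>Excludes the dummy iterate at index 0 and makes
    \<open>Suc (k \<delta> - 1) = k \<delta>\<close> under truncated subtraction.\<close>
  have "eventually (\<lambda>\<delta>. k \<delta> \<ge> 1) (at_right 0)"
    using stop_infinity by (simp add: filterlim_at_top)
  with eventually_at_right_less[of "0::real"]
  have "eventually (\<lambda>\<delta>. b \<delta> (k \<delta>) \<le> exp (- (c * c0) * harm (k \<delta> - 1)) * (norm (x1 - x))\<^sup>2
      + \<delta>\<^sup>2 / (?n * c)) (at_right 0)"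
  proof eventually_elim
    case (elim \<delta>)
    then show ?case using bound[of \<delta> "k \<delta> - 1"] by simp
  qed
  then have "((\<lambda>\<delta>. b \<delta> (k \<delta>)) \<longlongrightarrow> 0) (at_right 0)"
    by (rule tendsto_sandwich[OF _ _ tendsto_const upper, rotated]) (simp add: b_def)
  then show ?thesis
    by (simp add: b_def x_def)
qed

end
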